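(* Let $\alpha\in(0,1]$, $\theta>0$, $\beta_0\ge0$. Let $B=\{B(t),t\ge0\}$ be a standard Brownian motion and let $S_{\alpha,\theta}$ be a subordinator, independent of $B$, with $\mathbb{E}e^{-\eta S_{\alpha,\theta}(t)}=\exp\{-t[\alpha\gamma(\alpha;\eta+\theta)-\alpha\gamma(\alpha;\theta)]\}$. Then for all $t,\tau\ge0$, $\mathbb{E}B(\beta_0t+S_{\alpha,\theta}(t))=0$ and $$\mathrm{Cov}\bigl(B(\beta_0t+S_{\alpha,\theta}(t)),\,B(\beta_0\tau+S_{\alpha,\theta}(\tau))\bigr)=\beta_0(t\wedge\tau)+(t\wedge\tau)\,\alpha\,\theta^{\alpha-1}e^{-\theta}.$$
   Context: $\gamma(\alpha;x)=\int_0^x e^{-w}w^{\alpha-1}\,dw$ is the lower-incomplete gamma function. A subordinator is a real-valued Lévy process with non-decreasing paths started at $0$. $t\wedge\tau=\min(t,\tau)$. *)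

theory Defs
  imports "HOL-Probability.Probability"
begin

definition lower_gamma :: "real \<Rightarrow> real \<Rightarrow> real" where
  "lower_gamma \<alpha> x = (LBINT w:{0..x}. exp (- w) * w powr (\<alpha> - 1))"

text \<open>
  A real-valued process is a function \<open>X :: real \<Rightarrow> 'a \<Rightarrow> real\<close>, time first. The time set is
  \<open>{0..}\<close>: values at negative times are unconstrained and never used.
\<close>

context prob_space
begin

definition covariance :: "('a \<Rightarrow> real) \<Rightarrow> ('a \<Rightarrow> real) \<Rightarrow> real" where
  "covariance X Y =
     expectation (\<lambda>\<omega>. (X \<omega> - expectation X) * (Y \<omega> - expectation Y))"

definition indep_increments :: "(real \<Rightarrow> 'a \<Rightarrow> real) \<Rightarrow> bool" where
  "indep_increments X \<longleftrightarrow>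
     (\<forall>(n::nat) (s::nat \<Rightarrow> real). 0 \<le> s 0 \<and> (\<forall>i<n. s i \<le> s (Suc i)) \<longrightarrow>
        indep_vars (\<lambda>_. borel) (\<lambda>i \<omega>. X (s (Suc i)) \<omega> - X (s i) \<omega>) {..<n})"

definition indep_processes :: "(real \<Rightarrow> 'a \<Rightarrow> real) \<Rightarrow> (real \<Rightarrow> 'a \<Rightarrow> real) \<Rightarrow> bool" where
  "indep_processes X Y \<longleftrightarrow>
     indep_var (Pi\<^sub>M {0..} (\<lambda>_. borel)) (\<lambda>\<omega>. \<lambda>t\<in>{0..}. X t \<omega>)
               (Pi\<^sub>M {0..} (\<lambda>_. borel)) (\<lambda>\<omega>. \<lambda>t\<in>{0..}. Y t \<omega>)"

end

locale levy_process = prob_space M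
  for M :: "'a measure" and X :: "real \<Rightarrow> 'a \<Rightarrow> real" +
  assumes rv: "\<And>t. 0 \<le> t \<Longrightarrow> random_variable borel (X t)"
    and start: "AE \<omega> in M. X 0 \<omega> = 0"
    and indep_increments: "indep_increments X"
    and stationary_increments: "\<And>s h. 0 \<le> s \<Longrightarrow> 0 \<le> h \<Longrightarrow>
          distr M borel (\<lambda>\<omega>. X (s + h) \<omega> - X s \<omega>) = distr M borel (\<lambda>\<omega>. X h \<omega> - X 0 \<omega>)"
    and stochastically_continuous: "\<And>t e. 0 \<le> t \<Longrightarrow> 0 < e \<Longrightarrow>
          ((\<lambda>s. prob {\<omega> \<in> space M. e < \<bar>X s \<omega> - X t \<omega>\<bar>}) \<longlongrightarrow> 0) (at t within {0..})"

text \<open>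
  Path properties of subordinators and of Brownian motion are required for every outcome, not
  just almost every one. With this, \<open>\<lambda>\<omega>. B (b * t + S t \<omega>) \<omega>\<close> evaluates \<open>B\<close> at nonnegative
  times only and is measurable without completing \<open>M\<close>.
\<close>

locale subordinator = levy_process M X
  for M :: "'a measure" and X :: "real \<Rightarrow> 'a \<Rightarrow> real" +
  assumes start_at_0: "\<And>\<omega>. \<omega> \<in> space M \<Longrightarrow> X 0 \<omega> = 0"
    and nondecreasing_paths: "\<And>\<omega>. \<omega> \<in> space M \<Longrightarrow> mono_on {0..} (\<lambda>t. X t \<omega>)"

locale standard_brownian_motion = prob_space M
  for M :: "'a measure" and B :: "real \<Rightarrow> 'a \<Rightarrow> real" +
  assumes rv: "\<And>t. 0 \<le> t \<Longrightarrow> random_variable borel (B t)"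
    and start: "AE \<omega> in M. B 0 \<omega> = 0"
    and indep_increments: "indep_increments B"
    and normal_increments: "\<And>s t. 0 \<le> s \<Longrightarrow> s < t \<Longrightarrow>
          distributed M lborel (\<lambda>\<omega>. B t \<omega> - B s \<omega>) (normal_density 0 (sqrt (t - s)))"
    and continuous_paths: "\<And>\<omega>. \<omega> \<in> space M \<Longrightarrow> continuous_on {0..} (\<lambda>t. B t \<omega>)"

end

theory Submission
  imports Defs
begin

text \<open>
  By independence the time change can be frozen: Fubini on the product of the two path laws gives
  \<open>E (B\<^sub>U\<^sup>2) = E U\<close> and \<open>E (B\<^sub>U * B\<^sub>V) = E (min U V)\<close> for nonnegative integrable random times \<open>U\<close>, \<open>V\<close>
  independent of \<open>B\<close>. For \<open>U = \<beta>\<^sub>0 * t + S t\<close> and \<open>V = \<beta>\<^sub>0 * \<tau> + S \<tau>\<close>, monotonicity of \<open>S\<close> turns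
  \<open>min U V\<close> into the value of the clock at \<open>min t \<tau>\<close>, whose mean is read off the derivative of the
  Laplace transform at \<open>0\<close>.
\<close>

section \<open>Derivative of the lower incomplete gamma function\<close>

text \<open>For \<alpha> < 1 the integrand is unbounded near 0. It is the nonnegative integrand of
  Euler's integral for Gamma, hence absolutely integrable over the half-line and over every subset
  \<open>{0..x}\<close>.\<close>

lemma set_integrable_lower_gamma:
  fixes \<alpha> x :: real
  assumes "0 < \<alpha>"
  shows "set_integrable lborel {0..x} (\<lambda>w. exp (- w) * w powr (\<alpha> - 1))"
proof -
  have eq: "t powr (\<alpha> - 1) / exp t = exp (- t) * t powr (\<alpha> - 1)" for t :: real
    by (simp add: exp_minus field_simps)
  have "(\<lambda>t. t powr (\<alpha> - 1) / exp t) integrable_on {0..}"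
    using Gamma_integral_real[OF assms] by blast
  then have "(\<lambda>t. t powr (\<alpha> - 1) / exp t) absolutely_integrable_on {0..}"
    by (rule nonnegative_absolutely_integrable_1) simp
  then have "set_integrable lborel {0..} (\<lambda>t. exp (- t) * t powr (\<alpha> - 1))"
    unfolding set_integrable_def eq by (subst (asm) integrable_completion) simp_all
  then show ?thesis
    by (rule set_integrable_subset) auto
qed

text \<open>Moves the singularity at 0 into a constant, so that the fundamental theorem of calculus
  applies to the remaining continuous integrand.\<close>

lemma lower_gamma_split:
  fixes \<alpha> a x :: real
  assumes "0 < \<alpha>" "0 < a" "a \<le> x"
  shows "lower_gamma \<alpha> x =
    lower_gamma \<alpha> a + integral {a..x} (\<lambda>w. exp (- w) * w powr (\<alpha> - 1))"
proof -
  let ?f = "\<lambda>w::real. exp (- w) * w powr (\<alpha> - 1)"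
  have eq: "lower_gamma \<alpha> y = integral {0..y} ?f" for y
    unfolding lower_gamma_def
    by (rule set_borel_integral_eq_integral(2)[OF set_integrable_lower_gamma[OF assms(1)]])
  have "?f integrable_on {0..x}"
    by (rule set_borel_integral_eq_integral(1)[OF set_integrable_lower_gamma[OF assms(1)]])
  then show ?thesis
    unfolding eq using Henstock_Kurzweil_Integration.integral_combine[of 0 a x ?f] assms by simp
qed

lemma lower_gamma_has_real_derivative:
  fixes \<alpha> x :: real
  assumes "0 < \<alpha>" "0 < x"
  shows "(lower_gamma \<alpha> has_real_derivative exp (- x) * x powr (\<alpha> - 1)) (at x)"
proof -
  let ?f = "\<lambda>w::real. exp (- w) * w powr (\<alpha> - 1)"
  \<comment> \<open>The left endpoint x/2 stays away from the singularity, and x is interior to the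
    interval, so the derivative within it is a two-sided one.\<close>
  have "continuous_on {x/2..x+1} ?f"
    using assms by (auto intro!: continuous_intros)
  then have "((\<lambda>y. integral {x/2..y} ?f) has_real_derivative ?f x) (at x within {x/2..x+1})"
    using assms by (intro integral_has_real_derivative) auto
  then have "((\<lambda>y. integral {x/2..y} ?f) has_real_derivative ?f x) (at x)"
    using assms by (subst (asm) at_within_Icc_at) auto
  from DERIV_add[OF DERIV_const this]
  have "((\<lambda>y. lower_gamma \<alpha> (x/2) + integral {x/2..y} ?f) has_real_derivative ?f x) (at x)"
    by simp
  then show ?thesis
  proof (rule has_field_derivative_transform_within_open[where S="{x/2<..}"])
    show "lower_gamma \<alpha> (x/2) + integral {x/2..y} ?f = lower_gamma \<alpha> y" if "y \<in> {x/2<..}" for y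
      by (rule lower_gamma_split[symmetric]) (use assms that in auto)
  qed (use assms in auto)
qed

section \<open>Mean of a nonnegative variable from its Laplace transform\<close>

text \<open>The derivative is one-sided because the transform is prescribed for \<eta> \<ge> 0 only,
  and integrability of \<open>X\<close> is a conclusion. The quotients \<open>q n\<close> lie
  between 0 and \<open>X\<close> and tend to \<open>X\<close> pointwise, while their means are
  difference quotients of the transform and tend to \<open>m\<close>.\<close>

lemma (in prob_space) expectation_eq_minus_Laplace_derivative:
  fixes X :: "'a \<Rightarrow> real"
  assumes [measurable]: "random_variable borel X"
    and nonneg: "\<And>\<omega>. \<omega> \<in> space M \<Longrightarrow> 0 \<le> X \<omega>"
    and deriv: "((\<lambda>\<eta>. expectation (\<lambda>\<omega>. exp (- \<eta> * X \<omega>))) has_real_derivative - m) (at 0 within {0..})"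
  shows "integrable M X" "expectation X = m"
proof -
  \<comment> \<open>\<open>Suc\<close> keeps every \<open>h n\<close> positive, so the sequence
    approaches 0 inside \<open>{0..}\<close> without hitting it, as the filter
    \<open>at 0 within {0..}\<close> demands.\<close>
  define h where "h n = 1 / real (Suc n)" for n
  define q where "q n \<omega> = (1 - exp (- h n * X \<omega>)) / h n" for n \<omega>
  have h_pos: "0 < h n" for n by (simp add: h_def)
  have h_lim: "h \<longlonglongrightarrow> 0"
    unfolding h_def by (rule LIMSEQ_Suc[OF lim_1_over_n])
  have h_at: "filterlim h (at 0 within {0..}) sequentially"
    using h_lim h_pos by (auto simp: filterlim_at less_imp_le intro!: always_eventually)
      (metis less_irrefl)
  have q_meas[measurable]: "q n \<in> borel_measurable M" for n
    unfolding q_def by measurable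
  have int_exp: "integrable M (\<lambda>\<omega>. exp (- h n * X \<omega>))" for n
    using h_pos[of n] nonneg
    by (intro integrable_const_bound[where B=1]) (auto intro!: AE_I2 mult_nonneg_nonneg less_imp_le)
  then have q_int: "integrable M (q n)" for n
    unfolding q_def by auto
  have q_nonneg: "0 \<le> q n \<omega>" if "\<omega> \<in> space M" for n \<omega>
    using nonneg[OF that] h_pos[of n] by (auto simp: q_def intro!: divide_nonneg_pos mult_nonneg_nonneg)
  have q_le: "q n \<omega> \<le> X \<omega>" for n \<omega>
    using exp_ge_add_one_self[of "- h n * X \<omega>"] h_pos[of n]
    by (simp add: q_def divide_le_eq mult.commute)
  have q_lim: "(\<lambda>n. q n \<omega>) \<longlonglongrightarrow> X \<omega>" for \<omega>
  proof -
    have "((\<lambda>\<eta>. 1 - exp (- \<eta> * X \<omega>)) has_real_derivative X \<omega>) (at 0 within {0..})"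
      by (auto intro!: derivative_eq_intros)
    then have "((\<lambda>\<eta>. (1 - exp (- \<eta> * X \<omega>)) / \<eta>) \<longlongrightarrow> X \<omega>) (at 0 within {0..})"
      by (simp add: has_field_derivative_iff)
    from filterlim_compose[OF this h_at] show ?thesis
      by (simp add: q_def)
  qed
  have Eq_lim: "(\<lambda>n. expectation (q n)) \<longlonglongrightarrow> m"
  proof -
    let ?L = "\<lambda>\<eta>. expectation (\<lambda>\<omega>. exp (- \<eta> * X \<omega>))"
    have "((\<lambda>\<eta>. (?L \<eta> - 1) / \<eta>) \<longlongrightarrow> - m) (at 0 within {0..})"
      using deriv by (simp add: has_field_derivative_iff prob_space)
    from tendsto_minus[OF filterlim_compose[OF this h_at]]
    have "(\<lambda>n. (1 - ?L (h n)) / h n) \<longlonglongrightarrow> m"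
      by (simp add: minus_divide_left)
    moreover have "expectation (q n) = (1 - ?L (h n)) / h n" for n
      unfolding q_def using int_exp[of n] by (simp add: prob_space)
    ultimately show ?thesis by simp
  qed
  \<comment> \<open>Fatou yields integrability of \<open>X\<close>, which then dominates the difference quotients.\<close>
  have "(\<integral>\<^sup>+\<omega>. ennreal (X \<omega>) \<partial>M) = (\<integral>\<^sup>+\<omega>. liminf (\<lambda>n. ennreal (q n \<omega>)) \<partial>M)"
    using q_lim by (intro nn_integral_cong) (auto intro!: lim_imp_Liminf[symmetric] tendsto_ennrealI)
  also have "\<dots> \<le> liminf (\<lambda>n. \<integral>\<^sup>+\<omega>. ennreal (q n \<omega>) \<partial>M)"
    by (rule nn_integral_liminf) measurable
  also have "\<dots> = liminf (\<lambda>n. ennreal (expectation (q n)))"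
    using q_int q_nonneg by (simp add: nn_integral_eq_integral)
  also have "\<dots> = ennreal m"
    using Eq_lim by (intro lim_imp_Liminf tendsto_ennrealI) auto
  finally have "(\<integral>\<^sup>+\<omega>. ennreal (X \<omega>) \<partial>M) < \<infinity>"
    by (auto intro: le_less_trans)
  then show X_int: "integrable M X"
    using nonneg by (intro integrableI_nonneg) auto
  have "(\<lambda>n. expectation (q n)) \<longlonglongrightarrow> expectation X"
  proof (rule integral_dominated_convergence[where w=X])
    show "AE \<omega> in M. norm (q n \<omega>) \<le> X \<omega>" for n
      using q_nonneg q_le by (auto intro!: AE_I2)
  qed (use X_int q_lim in auto)
  from LIMSEQ_unique[OF this Eq_lim] show "expectation X = m" .
qed

section \<open>Jointly measurable evaluation of paths\<close>

text \<open>
  The evaluation map \<open>(b, u) \<mapsto> b u\<close> is not measurable for the product sigma-algebra on paths; this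
  limit is, and it agrees with evaluation on paths that are continuous on \<open>{0..}\<close>.
\<close>

definition path_eval :: "(real \<Rightarrow> real) \<Rightarrow> real \<Rightarrow> real" where
  "path_eval b u = lim (\<lambda>n. b (real (nat \<lfloor>real (Suc n) * u\<rfloor>) / real (Suc n)))"

text \<open>At stage n the discretised time takes only the countably many values k / (n + 1). For
  each of them evaluation is a coordinate projection, so every stage is measurable, and so is the
  limit. Since \<open>nat\<close> sends negative times to 0, the coordinates never leave
  \<open>{0..}\<close>.\<close>

lemma measurable_path_eval:
  assumes [measurable]: "f \<in> N \<rightarrow>\<^sub>M Pi\<^sub>M {0..} (\<lambda>_. borel)" "g \<in> borel_measurable N"
  shows "(\<lambda>x. path_eval (f x) (g x)) \<in> borel_measurable N"
  unfolding path_eval_def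
proof (intro borel_measurable_lim_metric)
  fix n
  show "(\<lambda>x. f x (real (nat \<lfloor>real (Suc n) * g x\<rfloor>) / real (Suc n))) \<in> borel_measurable N"
  proof (rule measurable_compose_countable[where f="\<lambda>k x. f x (real k / real (Suc n))"])
    show "(\<lambda>x. f x (real k / real (Suc n))) \<in> borel_measurable N" for k
      by (rule measurable_compose[OF assms(1) measurable_component_singleton]) simp
  qed measurable
qed

lemma path_eval_restrict_eq:
  assumes "continuous_on {0..} b" "0 \<le> u"
  shows "path_eval (\<lambda>t\<in>{0..}. b t) u = b u"
proof -
  define r where "r n = real (nat \<lfloor>real (Suc n) * u\<rfloor>) / real (Suc n)" for n
  have r_nonneg: "r n \<in> {0..}" for n by (simp add: r_def)
  have "r \<longlonglongrightarrow> u"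
  proof (rule tendsto_sandwich)
    have bounds: "u - 1 / real (Suc n) \<le> r n \<and> r n \<le> u" for n
    proof -
      \<comment> \<open>For u \<ge> 0 the floor is nonnegative and \<open>nat\<close> does not
        change it, so the grid point lies below u by at most one mesh width.\<close>
      have "r n * real (Suc n) = of_int \<lfloor>u * real (Suc n)\<rfloor>"
        using assms(2) by (simp add: r_def mult.commute del: of_nat_Suc)
      then have "u * real (Suc n) - 1 \<le> r n * real (Suc n)" "r n * real (Suc n) \<le> u * real (Suc n)"
        by linarith+
      then show ?thesis
        by (simp add: field_simps del: of_nat_Suc)
    qed
    show "\<forall>\<^sub>F n in sequentially. u - 1 / real (Suc n) \<le> r n"
      and "\<forall>\<^sub>F n in sequentially. r n \<le> u"
      using bounds by simp_all
    show "(\<lambda>n. u - 1 / real (Suc n)) \<longlonglongrightarrow> u"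
      using tendsto_diff[OF tendsto_const LIMSEQ_Suc[OF lim_1_over_n]] by simp
  qed simp
  then have "(\<lambda>n. b (r n)) \<longlonglongrightarrow> b u"
    by (rule continuous_on_tendsto_compose[OF assms(1)]) (use assms(2) r_nonneg in auto)
  moreover have "path_eval (\<lambda>t\<in>{0..}. b t) u = lim (\<lambda>n. b (r n))"
    by (simp add: path_eval_def r_def)
  ultimately show ?thesis
    by (simp add: limI)
qed

section \<open>Fubini and Tonelli for independent variables\<close>

context prob_space
begin

text \<open>Independence makes the joint law the product of the marginals. After Tonelli both
  marginal integrals are pulled back to \<open>M\<close>, so \<omega>' fixes the value of
  \<open>Z\<close> while \<omega> still runs through \<open>X\<close>. This form serves to establish
  finiteness of second moments.\<close>

lemma indep_var_nn_integral:
  assumes indep: "indep_var N X L Z" and [measurable]: "f \<in> borel_measurable (N \<Otimes>\<^sub>M L)"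
  shows "(\<integral>\<^sup>+\<omega>. f (X \<omega>, Z \<omega>) \<partial>M) = (\<integral>\<^sup>+\<omega>'. (\<integral>\<^sup>+\<omega>. f (X \<omega>, Z \<omega>') \<partial>M) \<partial>M)"
proof -
  have X[measurable]: "random_variable N X" and Z[measurable]: "random_variable L Z"
    and eq: "distr M N X \<Otimes>\<^sub>M distr M L Z = distr M (N \<Otimes>\<^sub>M L) (\<lambda>\<omega>. (X \<omega>, Z \<omega>))"
    using indep by (auto simp: indep_var_distribution_eq)
  interpret P: prob_space "distr M N X" by (rule prob_space_distr) fact
  interpret Q: prob_space "distr M L Z" by (rule prob_space_distr) fact
  interpret pair_sigma_finite "distr M N X" "distr M L Z" ..
  have "(\<integral>\<^sup>+\<omega>. f (X \<omega>, Z \<omega>) \<partial>M) = (\<integral>\<^sup>+p. f p \<partial>(distr M N X \<Otimes>\<^sub>M distr M L Z))"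
    unfolding eq by (subst nn_integral_distr) simp_all
  also have "\<dots> = (\<integral>\<^sup>+z. (\<integral>\<^sup>+x. f (x, z) \<partial>distr M N X) \<partial>distr M L Z)"
    by (rule nn_integral_snd[symmetric]) simp
  also have "\<dots> = (\<integral>\<^sup>+\<omega>'. (\<integral>\<^sup>+x. f (x, Z \<omega>') \<partial>distr M N X) \<partial>M)"
    by (rule nn_integral_distr) measurable
  also have "\<dots> = (\<integral>\<^sup>+\<omega>'. (\<integral>\<^sup>+\<omega>. f (X \<omega>, Z \<omega>') \<partial>M) \<partial>M)"
    by (intro nn_integral_cong nn_integral_distr)
      (use measurable_space[OF Z] in measurable)
  finally show ?thesis .
qed

text \<open>The signed counterpart, by Fubini. In its applications the integrability hypothesis
  follows from the second moments obtained with the Tonelli form.\<close>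

lemma indep_var_integral:
  fixes f :: "'b \<times> 'b \<Rightarrow> real"
  assumes indep: "indep_var N X L Z" and [measurable]: "f \<in> borel_measurable (N \<Otimes>\<^sub>M L)"
    and int: "integrable M (\<lambda>\<omega>. f (X \<omega>, Z \<omega>))"
  shows "expectation (\<lambda>\<omega>. f (X \<omega>, Z \<omega>)) =
    expectation (\<lambda>\<omega>'. expectation (\<lambda>\<omega>. f (X \<omega>, Z \<omega>')))"
proof -
  have X[measurable]: "random_variable N X" and Z[measurable]: "random_variable L Z"
    and eq: "distr M N X \<Otimes>\<^sub>M distr M L Z = distr M (N \<Otimes>\<^sub>M L) (\<lambda>\<omega>. (X \<omega>, Z \<omega>))"
    using indep by (auto simp: indep_var_distribution_eq)
  interpret P: prob_space "distr M N X" by (rule prob_space_distr) fact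
  interpret Q: prob_space "distr M L Z" by (rule prob_space_distr) fact
  interpret pair_sigma_finite "distr M N X" "distr M L Z" ..
  have "integrable (distr M N X \<Otimes>\<^sub>M distr M L Z) f"
    unfolding eq using int by (subst integrable_distr_eq) simp_all
  then have "(\<integral>p. f p \<partial>(distr M N X \<Otimes>\<^sub>M distr M L Z)) =
      (\<integral>z. (\<integral>x. f (x, z) \<partial>distr M N X) \<partial>distr M L Z)"
    using integral_snd[of "\<lambda>x z. f (x, z)"] by simp
  moreover have "(\<integral>p. f p \<partial>(distr M N X \<Otimes>\<^sub>M distr M L Z)) = expectation (\<lambda>\<omega>. f (X \<omega>, Z \<omega>))"
    unfolding eq by (subst integral_distr) simp_all
  moreover have "(\<integral>z. (\<integral>x. f (x, z) \<partial>distr M N X) \<partial>distr M L Z) =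
      expectation (\<lambda>\<omega>'. \<integral>x. f (x, Z \<omega>') \<partial>distr M N X)"
    by (rule integral_distr) measurable
  \<comment> \<open>For fixed \<omega>' the point \<open>Z \<omega>'\<close> lies in the space of
    \<open>L\<close>, so the section of \<open>f\<close> through it is measurable on
    \<open>N\<close>.\<close>
  moreover have "\<dots> = expectation (\<lambda>\<omega>'. expectation (\<lambda>\<omega>. f (X \<omega>, Z \<omega>')))"
    by (intro Bochner_Integration.integral_cong refl integral_distr)
      (use measurable_space[OF Z] in measurable)
  ultimately show ?thesis by simp
qed

end

section \<open>First and second moments of Brownian motion\<close>

context standard_brownian_motion
begin

lemma increment_moments:
  assumes "0 \<le> s" "s \<le> t"
  shows "integrable M (\<lambda>\<omega>. B t \<omega> - B s \<omega>)"
    and "expectation (\<lambda>\<omega>. B t \<omega> - B s \<omega>) = 0"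
    and "integrable M (\<lambda>\<omega>. (B t \<omega> - B s \<omega>)\<^sup>2)"
    and "expectation (\<lambda>\<omega>. (B t \<omega> - B s \<omega>)\<^sup>2) = t - s"
proof -
  have [measurable]: "B s \<in> borel_measurable M" "B t \<in> borel_measurable M"
    using rv assms by auto
  have "expectation (\<lambda>\<omega>. B t \<omega> - B s \<omega>) = 0 \<and> integrable M (\<lambda>\<omega>. (B t \<omega> - B s \<omega>)\<^sup>2) \<and>
    expectation (\<lambda>\<omega>. (B t \<omega> - B s \<omega>)\<^sup>2) = t - s"
  \<comment> \<open>\<open>normal_increments\<close> covers s < t only; for s = t the increment is
    identically 0.\<close>
  proof (cases "s = t")
    case False
    then have st: "0 < sqrt (t - s)" using assms by simp
    have D: "distributed M lborel (\<lambda>\<omega>. B t \<omega> - B s \<omega>) (normal_density 0 (sqrt (t - s)))"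
      using False assms by (intro normal_increments) auto
    have "integrable M (\<lambda>\<omega>. (B t \<omega> - B s \<omega>)\<^sup>2)"
      using integrable_normal_moment[OF st, of 0 2] distributed_integrable[OF D, of "\<lambda>x. x\<^sup>2"] by simp
    then show ?thesis
      using normal_distributed_expectation[OF st D] normal_distributed_variance[OF st D] st
      by simp
  qed simp
  then show "expectation (\<lambda>\<omega>. B t \<omega> - B s \<omega>) = 0"
    and square: "integrable M (\<lambda>\<omega>. (B t \<omega> - B s \<omega>)\<^sup>2)"
    and "expectation (\<lambda>\<omega>. (B t \<omega> - B s \<omega>)\<^sup>2) = t - s"
    by auto
  show "integrable M (\<lambda>\<omega>. B t \<omega> - B s \<omega>)"
    by (rule square_integrable_imp_integrable[OF _ square]) measurable
qed

text \<open>\<open>B 0\<close> vanishes only almost surely, so the moments of \<open>B t\<close> are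
  those of the increment from time 0 up to a null set.\<close>

lemma moments:
  assumes "0 \<le> t"
  shows "expectation (B t) = 0"
    and "integrable M (\<lambda>\<omega>. (B t \<omega>)\<^sup>2)"
    and "expectation (\<lambda>\<omega>. (B t \<omega>)\<^sup>2) = t"
proof -
  have [measurable]: "B 0 \<in> borel_measurable M" "B t \<in> borel_measurable M"
    using rv assms by auto
  note inc = increment_moments[of 0 t]
  have "expectation (B t) = expectation (\<lambda>\<omega>. B t \<omega> - B 0 \<omega>)"
    by (rule integral_cong_AE) (use start in auto)
  then show "expectation (B t) = 0" using inc assms by simp
  have "integrable M (\<lambda>\<omega>. (B t \<omega>)\<^sup>2) \<longleftrightarrow> integrable M (\<lambda>\<omega>. (B t \<omega> - B 0 \<omega>)\<^sup>2)"
    by (rule integrable_cong_AE) (use start in auto)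
  then show "integrable M (\<lambda>\<omega>. (B t \<omega>)\<^sup>2)" using inc assms by simp
  have "expectation (\<lambda>\<omega>. (B t \<omega>)\<^sup>2) = expectation (\<lambda>\<omega>. (B t \<omega> - B 0 \<omega>)\<^sup>2)"
    by (rule integral_cong_AE) (use start in auto)
  then show "expectation (\<lambda>\<omega>. (B t \<omega>)\<^sup>2) = t" using inc assms by simp
qed

text \<open>Polarisation: for s \<le> t the second moments s, t and t - s of \<open>B s\<close>,
  \<open>B t\<close> and the increment give (s + t - (t - s)) / 2 = s.\<close>

lemma expectation_mult:
  assumes "0 \<le> s" "0 \<le> t"
  shows "expectation (\<lambda>\<omega>. B s \<omega> * B t \<omega>) = min s t"
proof -
  have *: "expectation (\<lambda>\<omega>. B s \<omega> * B t \<omega>) = s" if "0 \<le> s" "s \<le> t" for s t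
  proof -
    note [simp] = moments[of s] moments[of t] increment_moments[of s t]
    have "expectation (\<lambda>\<omega>. B s \<omega> * B t \<omega>) =
        expectation (\<lambda>\<omega>. ((B s \<omega>)\<^sup>2 + (B t \<omega>)\<^sup>2 - (B t \<omega> - B s \<omega>)\<^sup>2) / 2)"
      by (intro Bochner_Integration.integral_cong refl) (simp add: power2_eq_square algebra_simps)
    then show ?thesis
      using that by simp
  qed
  show ?thesis
    using *[of s t] *[of t s] assms by (cases "s \<le> t") (auto simp: mult.commute)
qed

section \<open>Brownian motion at independent random times\<close>

text \<open>
  \<open>indep_var\<close> forces both variables into one type, so random times enter as functionals \<open>u (Z \<omega>)\<close> of
  a second path \<open>Z \<omega>\<close>.
\<close>

context
  fixes L :: "(real \<Rightarrow> real) measure" and Z :: "'a \<Rightarrow> real \<Rightarrow> real"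
  assumes indep: "indep_var (Pi\<^sub>M {0..} (\<lambda>_. borel)) (\<lambda>\<omega>. \<lambda>t\<in>{0..}. B t \<omega>) L Z"
begin

context
  fixes u :: "(real \<Rightarrow> real) \<Rightarrow> real"
  assumes u[measurable]: "u \<in> borel_measurable L"
    and nonneg: "\<And>\<omega>. \<omega> \<in> space M \<Longrightarrow> 0 \<le> u (Z \<omega>)"
    and integrable: "integrable M (\<lambda>\<omega>. u (Z \<omega>))"
begin

text \<open>Since every path is continuous and the time is nonnegative, the composition coincides
  with \<open>path_eval\<close> for every outcome.\<close>

lemma random_time_measurable: "(\<lambda>\<omega>. B (u (Z \<omega>)) \<omega>) \<in> borel_measurable M"
proof -
  have "(\<lambda>\<omega>. path_eval (\<lambda>t\<in>{0..}. B t \<omega>) (u (Z \<omega>))) \<in> borel_measurable M"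
    using indep by (intro measurable_path_eval) (auto simp: indep_var_distribution_eq intro: measurable_compose[OF _ u])
  then show ?thesis
    using path_eval_restrict_eq[OF continuous_paths nonneg]
    by (subst measurable_cong[where g="\<lambda>\<omega>. path_eval (\<lambda>t\<in>{0..}. B t \<omega>) (u (Z \<omega>))"]) auto
qed

lemma random_time_square_integrable: "integrable M (\<lambda>\<omega>. (B (u (Z \<omega>)) \<omega>)\<^sup>2)"
proof -
  note [measurable] = random_time_measurable
  note [simp] = path_eval_restrict_eq[OF continuous_paths nonneg]
  have [measurable]: "(\<lambda>p. path_eval (fst p) (u (snd p))) \<in> borel_measurable (Pi\<^sub>M {0..} (\<lambda>_. borel) \<Otimes>\<^sub>M L)"
    by (intro measurable_path_eval) measurable
  let ?f = "\<lambda>p. ennreal ((path_eval (fst p) (u (snd p)))\<^sup>2)"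
  have [measurable]: "?f \<in> borel_measurable (Pi\<^sub>M {0..} (\<lambda>_. borel) \<Otimes>\<^sub>M L)"
    by measurable
  have "(\<integral>\<^sup>+\<omega>. ennreal ((B (u (Z \<omega>)) \<omega>)\<^sup>2) \<partial>M) =
      (\<integral>\<^sup>+\<omega>. ?f (\<lambda>t\<in>{0..}. B t \<omega>, Z \<omega>) \<partial>M)"
    by (intro nn_integral_cong) simp
  also have "\<dots> = (\<integral>\<^sup>+\<omega>'. (\<integral>\<^sup>+\<omega>. ?f (\<lambda>t\<in>{0..}. B t \<omega>, Z \<omega>') \<partial>M) \<partial>M)"
    by (rule indep_var_nn_integral[OF indep]) simp
  also have "\<dots> = (\<integral>\<^sup>+\<omega>'. (\<integral>\<^sup>+\<omega>. ennreal ((B (u (Z \<omega>')) \<omega>)\<^sup>2) \<partial>M) \<partial>M)"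
    by (intro nn_integral_cong) simp
  also have "\<dots> = (\<integral>\<^sup>+\<omega>'. ennreal (u (Z \<omega>')) \<partial>M)"
    using nonneg by (intro nn_integral_cong) (simp add: nn_integral_eq_integral moments)
  also have "\<dots> < \<infinity>"
    using integrable nonneg by (simp add: nn_integral_eq_integral)
  finally show ?thesis
    by (intro integrableI_nonneg) auto
qed

lemma random_time_integrable: "integrable M (\<lambda>\<omega>. B (u (Z \<omega>)) \<omega>)"
  using random_time_measurable random_time_square_integrable
  by (rule square_integrable_imp_integrable)

lemma random_time_expectation: "expectation (\<lambda>\<omega>. B (u (Z \<omega>)) \<omega>) = 0"
proof -
  note [simp] = path_eval_restrict_eq[OF continuous_paths nonneg]
  let ?f = "\<lambda>p. path_eval (fst p) (u (snd p))"
  have "expectation (\<lambda>\<omega>. B (u (Z \<omega>)) \<omega>) = expectation (\<lambda>\<omega>. ?f (\<lambda>t\<in>{0..}. B t \<omega>, Z \<omega>))"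
    by (intro Bochner_Integration.integral_cong) simp_all
  also have "\<dots> = expectation (\<lambda>\<omega>'. expectation (\<lambda>\<omega>. ?f (\<lambda>t\<in>{0..}. B t \<omega>, Z \<omega>')))"
  proof (rule indep_var_integral[OF indep])
    show "?f \<in> borel_measurable (Pi\<^sub>M {0..} (\<lambda>_. borel) \<Otimes>\<^sub>M L)"
      by (intro measurable_path_eval) measurable
    show "integrable M (\<lambda>\<omega>. ?f (\<lambda>t\<in>{0..}. B t \<omega>, Z \<omega>))"
      using random_time_integrable by (rule Bochner_Integration.integrable_cong[THEN iffD1, rotated 2]) simp_all
  qed
  also have "\<dots> = expectation (\<lambda>\<omega>'. expectation (B (u (Z \<omega>'))))"
    by (intro Bochner_Integration.integral_cong) simp_all
  also have "\<dots> = expectation (\<lambda>_. 0)"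
    using nonneg by (intro Bochner_Integration.integral_cong) (simp_all add: moments)
  finally show ?thesis by simp
qed

end

lemma random_times_expectation_mult:
  fixes u v :: "(real \<Rightarrow> real) \<Rightarrow> real"
  assumes [measurable]: "u \<in> borel_measurable L" "v \<in> borel_measurable L"
    and nonneg: "\<And>\<omega>. \<omega> \<in> space M \<Longrightarrow> 0 \<le> u (Z \<omega>)" "\<And>\<omega>. \<omega> \<in> space M \<Longrightarrow> 0 \<le> v (Z \<omega>)"
    and integrable: "integrable M (\<lambda>\<omega>. u (Z \<omega>))" "integrable M (\<lambda>\<omega>. v (Z \<omega>))"
  shows "integrable M (\<lambda>\<omega>. B (u (Z \<omega>)) \<omega> * B (v (Z \<omega>)) \<omega>)"
    and "expectation (\<lambda>\<omega>. B (u (Z \<omega>)) \<omega> * B (v (Z \<omega>)) \<omega>) =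
      expectation (\<lambda>\<omega>. min (u (Z \<omega>)) (v (Z \<omega>)))"
proof -
  note [measurable] = random_time_measurable[OF assms(1) nonneg(1) integrable(1)]
    random_time_measurable[OF assms(2) nonneg(2) integrable(2)]
  note squares = random_time_square_integrable[OF assms(1) nonneg(1) integrable(1)]
    random_time_square_integrable[OF assms(2) nonneg(2) integrable(2)]
  show int: "integrable M (\<lambda>\<omega>. B (u (Z \<omega>)) \<omega> * B (v (Z \<omega>)) \<omega>)"
  proof (rule Bochner_Integration.integrable_bound[OF Bochner_Integration.integrable_add[OF squares]])
    \<comment> \<open>With this bound the sum of the two squares is an integrable majorant of the
      product, as Fubini requires below.\<close>
    have "\<bar>x * y\<bar> \<le> \<bar>x\<^sup>2 + y\<^sup>2\<bar>" for x y :: real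
    proof -
      have "0 \<le> \<bar>x\<bar> * \<bar>y\<bar>" "2 * (\<bar>x\<bar> * \<bar>y\<bar>) \<le> x\<^sup>2 + y\<^sup>2"
        using sum_squares_bound[of "\<bar>x\<bar>" "\<bar>y\<bar>"] by simp_all
      then show ?thesis
        unfolding abs_mult by linarith
    qed
    then show "AE \<omega> in M. norm (B (u (Z \<omega>)) \<omega> * B (v (Z \<omega>)) \<omega>) \<le> norm ((B (u (Z \<omega>)) \<omega>)\<^sup>2 + (B (v (Z \<omega>)) \<omega>)\<^sup>2)"
      by (auto intro!: AE_I2)
  qed measurable
  note [simp] = path_eval_restrict_eq[OF continuous_paths nonneg(1)]
    path_eval_restrict_eq[OF continuous_paths nonneg(2)]
  let ?f = "\<lambda>p. path_eval (fst p) (u (snd p)) * path_eval (fst p) (v (snd p))"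
  have "expectation (\<lambda>\<omega>. B (u (Z \<omega>)) \<omega> * B (v (Z \<omega>)) \<omega>) =
      expectation (\<lambda>\<omega>. ?f (\<lambda>t\<in>{0..}. B t \<omega>, Z \<omega>))"
    by (intro Bochner_Integration.integral_cong) simp_all
  also have "\<dots> = expectation (\<lambda>\<omega>'. expectation (\<lambda>\<omega>. ?f (\<lambda>t\<in>{0..}. B t \<omega>, Z \<omega>')))"
  proof (rule indep_var_integral[OF indep])
    show "?f \<in> borel_measurable (Pi\<^sub>M {0..} (\<lambda>_. borel) \<Otimes>\<^sub>M L)"
      by (intro borel_measurable_times measurable_path_eval) measurable
    show "integrable M (\<lambda>\<omega>. ?f (\<lambda>t\<in>{0..}. B t \<omega>, Z \<omega>))"
      using int by (rule Bochner_Integration.integrable_cong[THEN iffD1, rotated 2]) simp_all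
  qed
  also have "\<dots> = expectation (\<lambda>\<omega>'. expectation (\<lambda>\<omega>. B (u (Z \<omega>')) \<omega> * B (v (Z \<omega>')) \<omega>))"
    by (intro Bochner_Integration.integral_cong) simp_all
  also have "\<dots> = expectation (\<lambda>\<omega>'. min (u (Z \<omega>')) (v (Z \<omega>')))"
    using nonneg by (intro Bochner_Integration.integral_cong) (simp_all add: expectation_mult)
  finally show "expectation (\<lambda>\<omega>. B (u (Z \<omega>)) \<omega> * B (v (Z \<omega>)) \<omega>) = expectation (\<lambda>\<omega>. min (u (Z \<omega>)) (v (Z \<omega>)))" .
qed

end

end

section \<open>Moments of the subordinated process\<close>

text \<open>The integrability clauses ensure that the mean and the product moment are genuine, since
  a Bochner integral is 0 by default when the function is not integrable.\<close>

theorem mainTheorem9: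
  fixes M :: "'a measure"
    and B S :: "real \<Rightarrow> 'a \<Rightarrow> real"
    and \<alpha> \<theta> \<beta>\<^sub>0 :: real
  assumes "0 < \<alpha>" "\<alpha> \<le> 1" "0 < \<theta>" "0 \<le> \<beta>\<^sub>0"
    and "standard_brownian_motion M B"
    and "subordinator M S"
    and "prob_space.indep_processes M B S"
    and "\<And>t \<eta>. 0 \<le> t \<Longrightarrow> 0 \<le> \<eta> \<Longrightarrow>
           (\<integral>\<omega>. exp (- \<eta> * S t \<omega>) \<partial>M)
             = exp (- t * (\<alpha> * lower_gamma \<alpha> (\<eta> + \<theta>) - \<alpha> * lower_gamma \<alpha> \<theta>))"
  defines "Y \<equiv> \<lambda>t \<omega>. B (\<beta>\<^sub>0 * t + S t \<omega>) \<omega>"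
  shows "\<forall>t\<ge>0. \<forall>\<tau>\<ge>0.
           integrable M (Y t) \<and> (\<integral>\<omega>. Y t \<omega> \<partial>M) = 0 \<and>
           integrable M (\<lambda>\<omega>. Y t \<omega> * Y \<tau> \<omega>) \<and>
           prob_space.covariance M (Y t) (Y \<tau>)
             = \<beta>\<^sub>0 * min t \<tau> + min t \<tau> * \<alpha> * \<theta> powr (\<alpha> - 1) * exp (- \<theta>)"
proof (intro allI impI)
  fix t \<tau> :: real
  assume t: "0 \<le> t" and \<tau>: "0 \<le> \<tau>"
  interpret standard_brownian_motion M B by fact
  interpret S: subordinator M S by fact
  \<comment> \<open>\<mu> is the derivative of the Laplace exponent at \<eta> = 0, the mean growth
    rate of the subordinator; \<open>T\<close> is the random clock.\<close>
  define \<mu> where "\<mu> = \<alpha> * \<theta> powr (\<alpha> - 1) * exp (- \<theta>)"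
  define T where "T r = (\<lambda>\<omega>. \<beta>\<^sub>0 * r + S r \<omega>)" for r
  have S_nonneg: "0 \<le> S r \<omega>" if "\<omega> \<in> space M" "0 \<le> r" for r \<omega>
    using mono_onD[OF S.nondecreasing_paths[OF that(1)], of 0 r] S.start_at_0[OF that(1)] that by simp
  have S_moments: "integrable M (S r) \<and> expectation (S r) = r * \<mu>" if r: "0 \<le> r" for r
  proof -
    \<comment> \<open>At \<eta> = 0 the exponent vanishes, so the outer exponential contributes the
      factor 1 to the chain rule.\<close>
    have "((\<lambda>\<eta>. exp (- r * (\<alpha> * lower_gamma \<alpha> (\<eta> + \<theta>) - \<alpha> * lower_gamma \<alpha> \<theta>)))
        has_real_derivative - (r * \<mu>)) (at 0 within {0..})"
      using assms(1,3)
      by (auto intro!: derivative_eq_intros DERIV_chain2[OF lower_gamma_has_real_derivative]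
          simp: \<mu>_def)
    \<comment> \<open>The two functions agree on all of \<open>{0..}\<close>, so the radius
      \<open>d=1\<close> is an arbitrary choice.\<close>
    then have "((\<lambda>\<eta>. expectation (\<lambda>\<omega>. exp (- \<eta> * S r \<omega>))) has_real_derivative - (r * \<mu>))
        (at 0 within {0..})"
      by (rule has_field_derivative_transform_within[where d=1]) (use assms(8)[OF r] in simp_all)
    with S.rv[OF r] S_nonneg[OF _ r] show ?thesis
      using expectation_eq_minus_Laplace_derivative by blast
  qed
  have T_nonneg: "0 \<le> T r \<omega>" if "\<omega> \<in> space M" "0 \<le> r" for r \<omega>
    using S_nonneg[OF that] that assms(4) by (simp add: T_def)
  have T_int: "integrable M (T r)" and T_exp: "expectation (T r) = \<beta>\<^sub>0 * r + r * \<mu>" if "0 \<le> r" for r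
    using S_moments[OF that] by (auto simp: T_def prob_space)
  have T_min: "min (T t \<omega>) (T \<tau> \<omega>) = T (min t \<tau>) \<omega>" if "\<omega> \<in> space M" for \<omega>
  proof -
    have "T r \<omega> \<le> T r' \<omega>" if "0 \<le> r" "r \<le> r'" for r r'
      unfolding T_def
      using mono_onD[OF S.nondecreasing_paths[OF \<open>\<omega> \<in> space M\<close>], of r r'] that assms(4)
      by (intro add_mono mult_left_mono) auto
    from this[of t \<tau>] this[of \<tau> t] show ?thesis
      using t \<tau> by (cases "t \<le> \<tau>") auto
  qed
  \<comment> \<open>The functional \<open>u r\<close> reads the clock at time r off the path
    \<open>Z \<omega>\<close>. A single \<open>Z\<close> serves both t and \<tau>, so the two random
    times are frozen together.\<close>
  define Z where "Z = (\<lambda>\<omega>. \<lambda>r\<in>{0..}. S r \<omega>)"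
  define u where "u r s = \<beta>\<^sub>0 * r + s r" for r and s :: "real \<Rightarrow> real"
  have indep: "indep_var (Pi\<^sub>M {0..} (\<lambda>_. borel)) (\<lambda>\<omega>. \<lambda>r\<in>{0..}. B r \<omega>)
      (Pi\<^sub>M {0..} (\<lambda>_. borel)) Z"
    using assms(7) by (simp add: indep_processes_def Z_def)
  have u: "u r \<in> borel_measurable (Pi\<^sub>M {0..} (\<lambda>_. borel))" if "0 \<le> r" for r
    unfolding u_def using that by (auto intro!: borel_measurable_add measurable_component_singleton)
  have uZ: "u r (Z \<omega>) = T r \<omega>" if "0 \<le> r" for r \<omega>
    using that by (simp add: u_def Z_def T_def)
  have Y: "Y r = (\<lambda>\<omega>. B (T r \<omega>) \<omega>)" for r
    by (simp add: Y_def T_def)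
  have Y_int: "integrable M (Y r)" and Y_exp: "expectation (Y r) = 0" if "0 \<le> r" for r
    using random_time_integrable[OF indep u[OF that]] random_time_expectation[OF indep u[OF that]]
      that T_nonneg T_int[OF that] by (simp_all add: Y uZ)
  have YY: "integrable M (\<lambda>\<omega>. Y t \<omega> * Y \<tau> \<omega>)"
    "expectation (\<lambda>\<omega>. Y t \<omega> * Y \<tau> \<omega>) = expectation (\<lambda>\<omega>. min (T t \<omega>) (T \<tau> \<omega>))"
    using random_times_expectation_mult[OF indep u[OF t] u[OF \<tau>]] t \<tau> T_nonneg T_int
    by (simp_all add: Y uZ)
  have "expectation (\<lambda>\<omega>. Y t \<omega> * Y \<tau> \<omega>) = expectation (T (min t \<tau>))"
    using YY(2) T_min by (simp add: Y cong: Bochner_Integration.integral_cong)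
  also have "\<dots> = \<beta>\<^sub>0 * min t \<tau> + min t \<tau> * \<mu>"
    using t \<tau> by (intro T_exp) simp
  \<comment> \<open>Both means vanish, so the covariance is the expectation of the product.\<close>
  finally show "integrable M (Y t) \<and> (\<integral>\<omega>. Y t \<omega> \<partial>M) = 0 \<and>
      integrable M (\<lambda>\<omega>. Y t \<omega> * Y \<tau> \<omega>) \<and>
      covariance (Y t) (Y \<tau>) = \<beta>\<^sub>0 * min t \<tau> + min t \<tau> * \<alpha> * \<theta> powr (\<alpha> - 1) * exp (- \<theta>)"
    using Y_int[OF t] Y_exp[OF t] Y_exp[OF \<tau>] YY(1)
    by (simp add: covariance_def \<mu>_def Y algebra_simps)
qed

end
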